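(* Let $r>0$ and assume that $\mathcal{B}_r\ne\emptyset$, with norm-minimal bump function $b_r^*$. Among all functions $f\in\mathcal{K}$ with $\|f\|_K\le 1$ and $f(x)=0$ for all $\|x\|_2\ge r$, the maximal value $f(0)$ at zero is attained for $f=b_r^*/\|b_r^*\|_K$.
   Context: $K$ is a continuous symmetric positive definite translation-invariant real-valued kernel on $\mathbb{R}^d\times\mathbb{R}^d$, and $\mathcal{K}$ is its native space, i.e. the Hilbert space of functions on $\mathbb{R}^d$ with inner product $(\cdot,\cdot)_K$ and norm $\|\cdot\|_K$ for which $K$ is the reproducing kernel. The set of bump functions of support radius $r$ is $\mathcal{B}_r:=\{b\in\mathcal{K} : b(0)=1,\ b(y)=0 \text{ for all } \|y\|_2\ge r\}$; if it is nonempty, $b_r^*$ denotes its unique element of minimal norm. *)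

theory Defs
  imports "HOL-Analysis.Analysis"
begin

definition symmetric_kernel :: "('a \<Rightarrow> 'a \<Rightarrow> real) \<Rightarrow> bool" where
  "symmetric_kernel K \<longleftrightarrow> (\<forall>x y. K x y = K y x)"

text \<open>All kernel matrices on finite point sets are required to be positive semidefinite, which is
  the condition characterizing reproducing kernels. Strictly positive definite kernels, which are
  also called positive definite in part of the literature, are a special case.\<close>

definition positive_definite_kernel :: "('a \<Rightarrow> 'a \<Rightarrow> real) \<Rightarrow> bool" where
  "positive_definite_kernel K \<longleftrightarrow>
     (\<forall>X (c :: 'a \<Rightarrow> real). finite X \<longrightarrow> 0 \<le> (\<Sum>x\<in>X. \<Sum>y\<in>X. c x * c y * K x y))"

definition translation_invariant_kernel :: "('a::plus \<Rightarrow> 'a \<Rightarrow> real) \<Rightarrow> bool" where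
  "translation_invariant_kernel K \<longleftrightarrow> (\<forall>x y z. K (x + z) (y + z) = K x y)"

definition ip_norm :: "(('a \<Rightarrow> real) \<Rightarrow> ('a \<Rightarrow> real) \<Rightarrow> real) \<Rightarrow> ('a \<Rightarrow> real) \<Rightarrow> real" where
  "ip_norm ip f = sqrt (ip f f)"

locale function_hilbert_space =
  fixes H :: "('a \<Rightarrow> real) set"
    and ip :: "('a \<Rightarrow> real) \<Rightarrow> ('a \<Rightarrow> real) \<Rightarrow> real"
  assumes zero_mem: "(\<lambda>x. 0) \<in> H"
    and add_mem: "\<lbrakk>f \<in> H; g \<in> H\<rbrakk> \<Longrightarrow> (\<lambda>x. f x + g x) \<in> H"
    and scale_mem: "f \<in> H \<Longrightarrow> (\<lambda>x. c * f x) \<in> H"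
    and ip_sym: "\<lbrakk>f \<in> H; g \<in> H\<rbrakk> \<Longrightarrow> ip f g = ip g f"
    and ip_add: "\<lbrakk>f \<in> H; g \<in> H; h \<in> H\<rbrakk> \<Longrightarrow> ip (\<lambda>x. f x + g x) h = ip f h + ip g h"
    and ip_scale: "\<lbrakk>f \<in> H; g \<in> H\<rbrakk> \<Longrightarrow> ip (\<lambda>x. c * f x) g = c * ip f g"
    and ip_nonneg: "f \<in> H \<Longrightarrow> 0 \<le> ip f f"
    and ip_definite: "\<lbrakk>f \<in> H; ip f f = 0\<rbrakk> \<Longrightarrow> f = (\<lambda>x. 0)"
    and complete: "\<lbrakk>\<And>n. F n \<in> H;
        \<And>e. 0 < e \<Longrightarrow> \<exists>N. \<forall>m\<ge>N. \<forall>n\<ge>N. ip_norm ip (\<lambda>x. F m x - F n x) < e\<rbrakk>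
      \<Longrightarrow> \<exists>f\<in>H. (\<lambda>n :: nat. ip_norm ip (\<lambda>x. F n x - f x)) \<longlonglongrightarrow> 0"

text \<open>By the Moore--Aronszajn theorem, \<open>K\<close> determines the set \<open>H\<close> and the inner product
  \<open>ip\<close> on \<open>H\<close> uniquely; the values of \<open>ip\<close> outside of \<open>H\<close> are irrelevant.\<close>

locale native_space = function_hilbert_space H ip
  for K :: "'a \<Rightarrow> 'a \<Rightarrow> real"
    and H :: "('a \<Rightarrow> real) set"
    and ip :: "('a \<Rightarrow> real) \<Rightarrow> ('a \<Rightarrow> real) \<Rightarrow> real" +
  assumes kernel_mem: "(\<lambda>y. K y x) \<in> H"
    and reproducing: "f \<in> H \<Longrightarrow> ip f (\<lambda>y. K y x) = f x"

definition bump_functions ::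
  "('a::real_normed_vector \<Rightarrow> real) set \<Rightarrow> real \<Rightarrow> ('a \<Rightarrow> real) set" where
  "bump_functions H r = {b \<in> H. b 0 = 1 \<and> (\<forall>y. norm y \<ge> r \<longrightarrow> b y = 0)}"

definition minimal_bump ::
  "('a::real_normed_vector \<Rightarrow> real) set \<Rightarrow> (('a \<Rightarrow> real) \<Rightarrow> ('a \<Rightarrow> real) \<Rightarrow> real)
     \<Rightarrow> real \<Rightarrow> 'a \<Rightarrow> real" where
  "minimal_bump H ip r = (THE b. is_arg_min (ip_norm ip) (\<lambda>b. b \<in> bump_functions H r) b)"

end

theory Submission
  imports Defs
begin

text \<open>Point evaluations on the native space are continuous, so \<open>bump_functions H r\<close> is a
  closed convex set and has a unique element \<open>b\<close> of minimal norm, by the parallelogram law. If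
  \<open>f\<close> is admissible with \<open>f 0 > 0\<close>, then \<open>f / f 0\<close> is a bump function, so
  \<open>ip_norm ip b \<le> ip_norm ip f / f 0 \<le> 1 / f 0\<close>. Hence \<open>f 0\<close> is at most
  \<open>1 / ip_norm ip b\<close>, the value of \<open>b / ip_norm ip b\<close> at zero.\<close>

context function_hilbert_space
begin

lemma diff_mem:
  assumes "f \<in> H" "g \<in> H"
  shows "(\<lambda>x. f x - g x) \<in> H"
  using add_mem[OF assms(1) scale_mem[OF assms(2), of "-1"]] by simp

lemma ip_diff:
  assumes "f \<in> H" "g \<in> H" "h \<in> H"
  shows "ip (\<lambda>x. f x - g x) h = ip f h - ip g h"
  using ip_add[OF assms(1) scale_mem[OF assms(2), of "-1"] assms(3)]
    ip_scale[OF assms(2,3), of "-1"] by simp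

lemma ip_add_right:
  assumes "f \<in> H" "g \<in> H" "h \<in> H"
  shows "ip h (\<lambda>x. f x + g x) = ip h f + ip h g"
  using ip_add[OF assms] ip_sym[OF assms(3) add_mem[OF assms(1,2)]]
    ip_sym[OF assms(3,1)] ip_sym[OF assms(3,2)] by linarith

lemma ip_diff_right:
  assumes "f \<in> H" "g \<in> H" "h \<in> H"
  shows "ip h (\<lambda>x. f x - g x) = ip h f - ip h g"
  using ip_diff[OF assms] ip_sym[OF assms(3) diff_mem[OF assms(1,2)]]
    ip_sym[OF assms(3,1)] ip_sym[OF assms(3,2)] by linarith

lemma ip_scale_right:
  assumes "f \<in> H" "g \<in> H"
  shows "ip g (\<lambda>x. c * f x) = c * ip g f"
  using ip_scale[OF assms, of c] ip_sym[OF assms(2) scale_mem[OF assms(1)], of c]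
    ip_sym[OF assms(2,1)] by simp

lemma ip_norm_nonneg: "f \<in> H \<Longrightarrow> 0 \<le> ip_norm ip f"
  by (simp add: ip_norm_def ip_nonneg)

lemma ip_norm_squared: "f \<in> H \<Longrightarrow> (ip_norm ip f)\<^sup>2 = ip f f"
  by (simp add: ip_norm_def ip_nonneg)

lemma ip_norm_eq_zero: "f \<in> H \<Longrightarrow> ip_norm ip f = 0 \<Longrightarrow> f = (\<lambda>x. 0)"
  using ip_definite by (simp add: ip_norm_def)

lemma ip_norm_scale:
  assumes "f \<in> H"
  shows "ip_norm ip (\<lambda>x. c * f x) = \<bar>c\<bar> * ip_norm ip f"
proof -
  have "ip (\<lambda>x. c * f x) (\<lambda>x. c * f x) = c\<^sup>2 * ip f f"
    using ip_scale[OF assms scale_mem[OF assms], of c c] ip_scale_right[OF assms assms, of c]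
    by (simp add: power2_eq_square)
  then show ?thesis
    by (simp add: ip_norm_def real_sqrt_mult)
qed

lemma ip_norm_minus_commute:
  assumes "f \<in> H" "g \<in> H"
  shows "ip_norm ip (\<lambda>x. f x - g x) = ip_norm ip (\<lambda>x. g x - f x)"
  using ip_norm_scale[OF diff_mem[OF assms], of "-1"] by simp

lemma Cauchy_Schwarz:
  assumes f: "f \<in> H" and g: "g \<in> H"
  shows "\<bar>ip f g\<bar> \<le> ip_norm ip f * ip_norm ip g"
proof (cases "ip g g = 0")
  case True
  then have "g = (\<lambda>x. 0)"
    using ip_definite g by simp
  then have "ip f g = 0"
    \<comment> \<open>The zero function is 0 times itself, so homogeneity makes its inner product
      with \<open>f\<close> vanish.\<close>
    using ip_scale_right[OF zero_mem f, of 0] by simp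
  then show ?thesis
    using f g by (simp add: ip_norm_nonneg)
next
  case False
  then have pos: "ip g g > 0"
    using ip_nonneg[OF g] by simp
  \<comment> \<open>\<open>t * g\<close> is the orthogonal projection of \<open>f\<close> onto the
    line spanned by \<open>g\<close>. The squared norm of the residual \<open>f - t * g\<close> is
    nonnegative, and this is the inequality to be shown.\<close>
  define t where "t = ip f g / ip g g"
  have tg: "(\<lambda>x. t * g x) \<in> H"
    using g by (rule scale_mem)
  have "0 \<le> ip (\<lambda>x. f x - t * g x) (\<lambda>x. f x - t * g x)"
    by (intro ip_nonneg diff_mem f tg)
  also have "\<dots> = ip f f - 2 * t * ip f g + t * (t * ip g g)"
    using f g tg ip_sym[OF g f]
    by (simp add: ip_diff ip_diff_right diff_mem ip_scale ip_scale_right)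
  also have "\<dots> = ip f f - (ip f g)\<^sup>2 / ip g g"
    using pos by (simp add: t_def power2_eq_square)
  finally have "(ip f g)\<^sup>2 \<le> ip f f * ip g g"
    using pos by (simp add: field_simps)
  then have "sqrt ((ip f g)\<^sup>2) \<le> sqrt (ip f f * ip g g)"
    by (rule real_sqrt_le_mono)
  then show ?thesis
    by (simp add: ip_norm_def real_sqrt_mult)
qed

lemma ip_norm_triangle:
  assumes f: "f \<in> H" and g: "g \<in> H"
  shows "ip_norm ip (\<lambda>x. f x + g x) \<le> ip_norm ip f + ip_norm ip g"
proof (rule power2_le_imp_le)
  have "(ip_norm ip (\<lambda>x. f x + g x))\<^sup>2 = ip f f + 2 * ip f g + ip g g"
    using f g ip_sym[OF g f] by (simp add: ip_norm_squared add_mem ip_add ip_add_right)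
  also have "\<dots> \<le> (ip_norm ip f + ip_norm ip g)\<^sup>2"
    using Cauchy_Schwarz[OF f g] f g by (simp add: power2_sum ip_norm_squared)
  finally show "(ip_norm ip (\<lambda>x. f x + g x))\<^sup>2 \<le> (ip_norm ip f + ip_norm ip g)\<^sup>2" .
qed (simp add: f g ip_norm_nonneg)

text \<open>The parallelogram law, written with the midpoint instead of the sum: in a convex set the
  midpoint is again a competitor, so a lower bound on its norm becomes an upper bound on the
  distance of \<open>f\<close> and \<open>g\<close>.\<close>

lemma parallelogram_midpoint:
  assumes f: "f \<in> H" and g: "g \<in> H"
  shows "(ip_norm ip (\<lambda>x. f x - g x))\<^sup>2 =
    2 * (ip_norm ip f)\<^sup>2 + 2 * (ip_norm ip g)\<^sup>2 - 4 * (ip_norm ip (\<lambda>x. (f x + g x) / 2))\<^sup>2"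
proof -
  have "ip_norm ip (\<lambda>x. (f x + g x) / 2) = ip_norm ip (\<lambda>x. f x + g x) / 2"
    using ip_norm_scale[OF add_mem[OF f g], of "1/2"] by simp
  then have "4 * (ip_norm ip (\<lambda>x. (f x + g x) / 2))\<^sup>2 = (ip_norm ip (\<lambda>x. f x + g x))\<^sup>2"
    by (simp only: power_divide) simp
  then show ?thesis
    using f g ip_sym[OF g f]
    by (simp add: ip_norm_squared add_mem diff_mem ip_add ip_add_right ip_diff
        ip_diff_right)
qed

text \<open>The projection theorem for the origin. The argument needs convexity only for midpoints
  and closedness only for sequences, so the hypotheses are stated in this form.\<close>

theorem unique_minimal_norm:
  assumes sub: "C \<subseteq> H" and ne: "C \<noteq> {}"
    and mid: "\<And>f g. f \<in> C \<Longrightarrow> g \<in> C \<Longrightarrow> (\<lambda>x. (f x + g x) / 2) \<in> C"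
    and closed: "\<And>F f. (\<And>n :: nat. F n \<in> C) \<Longrightarrow> f \<in> H \<Longrightarrow>
      (\<lambda>n. ip_norm ip (\<lambda>x. F n x - f x)) \<longlonglongrightarrow> 0 \<Longrightarrow> f \<in> C"
  shows "\<exists>!b. is_arg_min (ip_norm ip) (\<lambda>b. b \<in> C) b"
proof -
  define d where "d = (INF f\<in>C. ip_norm ip f)"
  have bdd: "bdd_below (ip_norm ip ` C)"
    using sub ip_norm_nonneg by (intro bdd_belowI[of _ 0]) auto
  have d_le: "d \<le> ip_norm ip f" if "f \<in> C" for f
    unfolding d_def using bdd that by (rule cINF_lower)
  have d_nonneg: "0 \<le> d"
    unfolding d_def using ne sub ip_norm_nonneg by (intro cINF_greatest) auto
  \<comment> \<open>Two elements of \<open>C\<close> whose norms are close to the infimum are close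
    to each other. This estimate yields both the Cauchy property of a minimizing sequence and the
    uniqueness of the minimizer.\<close>
  have dist: "(ip_norm ip (\<lambda>x. f x - g x))\<^sup>2 \<le>
      2 * ((ip_norm ip f)\<^sup>2 - d\<^sup>2) + 2 * ((ip_norm ip g)\<^sup>2 - d\<^sup>2)"
    if "f \<in> C" "g \<in> C" for f g
  proof -
    have "d\<^sup>2 \<le> (ip_norm ip (\<lambda>x. (f x + g x) / 2))\<^sup>2"
      using d_le[OF mid[OF that]] d_nonneg by (rule power_mono)
    then show ?thesis
      using parallelogram_midpoint[of f g] that sub by (simp add: subset_iff)
  qed
  have "\<exists>f\<in>C. ip_norm ip f < d + inverse (real (Suc n))" for n
    using cINF_less_iff[OF ne bdd, of "d + inverse (real (Suc n))"] by (simp add: d_def)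
  then obtain F where FC: "\<And>n. F n \<in> C"
    and F_less: "\<And>n. ip_norm ip (F n) < d + inverse (real (Suc n))"
    by metis
  have FH: "F n \<in> H" for n
    using FC sub by auto
  have F_lim: "(\<lambda>n. ip_norm ip (F n)) \<longlonglongrightarrow> d"
  proof (rule tendsto_sandwich[where f = "\<lambda>_. d"])
    show "(\<lambda>n. d + inverse (real (Suc n))) \<longlonglongrightarrow> d"
      by (rule LIMSEQ_inverse_real_of_nat_add)
  qed (simp_all add: d_le FC less_imp_le[OF F_less] del: of_nat_Suc)
  have excess_lim: "(\<lambda>n. (ip_norm ip (F n))\<^sup>2 - d\<^sup>2) \<longlonglongrightarrow> 0"
    using tendsto_diff[OF tendsto_power[OF F_lim, of 2] tendsto_const[of "d\<^sup>2"]] by simp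
  have "\<exists>N. \<forall>m\<ge>N. \<forall>n\<ge>N. ip_norm ip (\<lambda>x. F m x - F n x) < e" if "0 < e" for e
  proof -
    \<comment> \<open>\<open>dist\<close> doubles each of the two excesses over
      \<open>d\<^sup>2\<close>, so a quarter of \<open>e\<^sup>2\<close> for each adds up to
      \<open>e\<^sup>2\<close>.\<close>
    have "0 < e\<^sup>2 / 4"
      using that by simp
    then obtain N where N: "\<And>n. n \<ge> N \<Longrightarrow> (ip_norm ip (F n))\<^sup>2 - d\<^sup>2 < e\<^sup>2 / 4"
      using order_tendstoD(2)[OF excess_lim] unfolding eventually_sequentially by metis
    have "ip_norm ip (\<lambda>x. F m x - F n x) < e" if "m \<ge> N" "n \<ge> N" for m n
    proof (rule power2_less_imp_less)
      show "(ip_norm ip (\<lambda>x. F m x - F n x))\<^sup>2 < e\<^sup>2"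
        using dist[OF FC FC, of m n] N[OF that(1)] N[OF that(2)] by (simp add: field_simps)
    qed (use \<open>0 < e\<close> in simp)
    then show ?thesis
      by blast
  qed
  then obtain b where bH: "b \<in> H" and b_lim: "(\<lambda>n. ip_norm ip (\<lambda>x. F n x - b x)) \<longlonglongrightarrow> 0"
    using complete[of F] FH by blast
  have bC: "b \<in> C"
    using closed[OF FC bH b_lim] .
  \<comment> \<open>Triangle inequality for \<open>b = F n + (b - F n)\<close>; letting
    \<open>n\<close> tend to infinity shows that the infimum \<open>d\<close> is attained at
    \<open>b\<close>.\<close>
  have "ip_norm ip b \<le> ip_norm ip (F n) + ip_norm ip (\<lambda>x. F n x - b x)" for n
    using ip_norm_triangle[OF FH[of n] diff_mem[OF bH FH[of n]]]
      ip_norm_minus_commute[OF bH FH[of n]] by simp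
  moreover have "(\<lambda>n. ip_norm ip (F n) + ip_norm ip (\<lambda>x. F n x - b x)) \<longlonglongrightarrow> d"
    using tendsto_add[OF F_lim b_lim] by simp
  ultimately have b_le: "ip_norm ip b \<le> d"
    by (intro LIMSEQ_le_const) auto
  show ?thesis
  proof (rule ex1I)
    show "is_arg_min (ip_norm ip) (\<lambda>b. b \<in> C) b"
      using bC b_le d_le by (force simp: is_arg_min_linorder)
  next
    fix c assume c: "is_arg_min (ip_norm ip) (\<lambda>b. b \<in> C) c"
    then have cC: "c \<in> C" and "ip_norm ip c \<le> ip_norm ip b"
      using bC by (auto simp: is_arg_min_linorder)
    \<comment> \<open>With both norms equal to \<open>d\<close>, the right-hand side of
      \<open>dist\<close> is zero, and definiteness identifies \<open>c\<close> with
      \<open>b\<close>.\<close>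
    then have "ip_norm ip c = d" "ip_norm ip b = d"
      using b_le d_le[OF cC] d_le[OF bC] by linarith+
    then have "ip_norm ip (\<lambda>x. c x - b x) = 0"
      using dist[OF cC bC] by simp
    then have "(\<lambda>x. c x - b x) = (\<lambda>x. 0)"
      using ip_norm_eq_zero diff_mem cC bC sub by blast
    then show "c = b"
      by (simp add: fun_eq_iff)
  qed
qed

end

text \<open>Evaluation at \<open>x\<close> is the inner product with the kernel function at
  \<open>x\<close>, so by Cauchy-Schwarz the pointwise error is at most the norm error times a
  constant depending only on \<open>x\<close>.\<close>

lemma (in native_space) tendsto_pointwise:
  assumes F: "\<And>n. F n \<in> H" and f: "f \<in> H"
    and lim: "(\<lambda>n :: nat. ip_norm ip (\<lambda>x. F n x - f x)) \<longlonglongrightarrow> 0"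
  shows "(\<lambda>n. F n x) \<longlonglongrightarrow> f x"
proof -
  let ?k = "\<lambda>y. K y x"
  have "(\<lambda>n. F n x - f x) \<longlonglongrightarrow> 0"
  proof (rule Lim_null_comparison)
    have "\<bar>F n x - f x\<bar> \<le> ip_norm ip (\<lambda>x. F n x - f x) * ip_norm ip ?k" for n
      using Cauchy_Schwarz[OF diff_mem[OF F[of n] f] kernel_mem[of x]]
        reproducing[OF diff_mem[OF F[of n] f], of x] by simp
    then show "\<forall>\<^sub>F n in sequentially.
        norm (F n x - f x) \<le> ip_norm ip (\<lambda>x. F n x - f x) * ip_norm ip ?k"
      by simp
    show "(\<lambda>n. ip_norm ip (\<lambda>x. F n x - f x) * ip_norm ip ?k) \<longlonglongrightarrow> 0"
      using tendsto_mult_left_zero[OF lim] .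
  qed
  then show ?thesis
    by (rule LIM_zero_cancel)
qed

text \<open>Justifies the definite description in \<open>minimal_bump\<close>. Each bump condition
  prescribes the value at one point, so it survives midpoints and pointwise limits, hence also norm
  limits.\<close>

lemma minimal_bump_is_arg_min:
  fixes K :: "'a::real_normed_vector \<Rightarrow> 'a \<Rightarrow> real"
  assumes "native_space K H ip" and ne: "bump_functions H r \<noteq> {}"
  shows "is_arg_min (ip_norm ip) (\<lambda>b. b \<in> bump_functions H r) (minimal_bump H ip r)"
proof -
  interpret native_space K H ip by fact
  have "\<exists>!b. is_arg_min (ip_norm ip) (\<lambda>b. b \<in> bump_functions H r) b"
  proof (rule unique_minimal_norm)
    show "bump_functions H r \<subseteq> H"
      by (auto simp: bump_functions_def)
  next
    fix f g assume "f \<in> bump_functions H r" "g \<in> bump_functions H r"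
    then show "(\<lambda>x. (f x + g x) / 2) \<in> bump_functions H r"
      using scale_mem[OF add_mem[of f g], of "1/2"] by (auto simp: bump_functions_def)
  next
    fix F f assume F: "\<And>n :: nat. F n \<in> bump_functions H r" and f: "f \<in> H"
      and lim: "(\<lambda>n. ip_norm ip (\<lambda>x. F n x - f x)) \<longlonglongrightarrow> 0"
    have "F n \<in> H" for n
      using F[of n] by (simp add: bump_functions_def)
    then have pw: "(\<lambda>n. F n x) \<longlonglongrightarrow> f x" for x
      using f lim by (rule tendsto_pointwise)
    have "f 0 = 1"
      using F LIMSEQ_unique[OF pw[of 0]] by (simp add: bump_functions_def)
    moreover have "f y = 0" if "norm y \<ge> r" for y
      using F that LIMSEQ_unique[OF pw[of y]] by (simp add: bump_functions_def)
    ultimately show "f \<in> bump_functions H r"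
      using f by (simp add: bump_functions_def)
  qed (rule ne)
  then show ?thesis
    unfolding minimal_bump_def by (rule theI')
qed

theorem theorem6:
  fixes K :: "real^'d \<Rightarrow> real^'d \<Rightarrow> real"
    and H :: "(real^'d \<Rightarrow> real) set"
    and ip :: "(real^'d \<Rightarrow> real) \<Rightarrow> (real^'d \<Rightarrow> real) \<Rightarrow> real"
    and r :: real
  assumes "continuous_on UNIV (\<lambda>(x, y). K x y)"
    and "symmetric_kernel K"
    and "positive_definite_kernel K"
    and "translation_invariant_kernel K"
    and "native_space K H ip"
    and "r > 0"
    and "bump_functions H r \<noteq> {}"
  shows "is_arg_max (\<lambda>f. f 0)
           (\<lambda>f. f \<in> H \<and> ip_norm ip f \<le> 1 \<and> (\<forall>x. norm x \<ge> r \<longrightarrow> f x = 0))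
           (\<lambda>x. minimal_bump H ip r x / ip_norm ip (minimal_bump H ip r))"
proof -
  interpret native_space K H ip by fact
  define b where "b = minimal_bump H ip r"
  define N where "N = ip_norm ip b"
  have "is_arg_min (ip_norm ip) (\<lambda>b. b \<in> bump_functions H r) b"
    unfolding b_def using assms(5,7) by (rule minimal_bump_is_arg_min)
  then have b: "b \<in> H" "b 0 = 1" "\<And>y. norm y \<ge> r \<Longrightarrow> b y = 0"
    and N_le: "\<And>c. c \<in> bump_functions H r \<Longrightarrow> N \<le> ip_norm ip c"
    by (auto simp: is_arg_min_linorder bump_functions_def N_def)
  \<comment> \<open>A bump function takes the value 1 at zero, so it is not the zero
    function.\<close>
  have N_pos: "N > 0"
    using ip_norm_nonneg[OF b(1)] ip_norm_eq_zero[OF b(1)] b(2) by (fastforce simp: N_def)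
  have f_le: "f 0 \<le> 1 / N"
    if f: "f \<in> H" "ip_norm ip f \<le> 1" "\<And>x. norm x \<ge> r \<Longrightarrow> f x = 0" for f
  proof (cases "f 0 > 0")
    case True
    then have "(\<lambda>x. 1 / f 0 * f x) \<in> bump_functions H r"
      using f scale_mem[OF f(1), of "1 / f 0"] by (simp add: bump_functions_def)
    from N_le[OF this] have "N \<le> ip_norm ip f / f 0"
      using ip_norm_scale[OF f(1), of "1 / f 0"] True by simp
    also have "\<dots> \<le> 1 / f 0"
      using f(2) True by (simp add: divide_right_mono)
    finally show ?thesis
      using True N_pos by (simp add: field_simps)
  next
    \<comment> \<open>A nonpositive value lies below the positive bound without any
      rescaling.\<close>
    case False
    then show ?thesis
      using N_pos by (smt (verit) divide_pos_pos)
  qed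
  \<comment> \<open>The normalized bump is admissible, and since \<open>b 0 = 1\<close> its value at
    zero is exactly the bound of \<open>f_le\<close>.\<close>
  have "(\<lambda>x. b x / N) \<in> H" "ip_norm ip (\<lambda>x. b x / N) = 1"
    using scale_mem[OF b(1), of "1 / N"] ip_norm_scale[OF b(1), of "1 / N"] N_pos
    by (simp_all add: N_def)
  then have "is_arg_max (\<lambda>f. f 0)
      (\<lambda>f. f \<in> H \<and> ip_norm ip f \<le> 1 \<and> (\<forall>x. norm x \<ge> r \<longrightarrow> f x = 0)) (\<lambda>x. b x / N)"
    using b f_le by (auto simp: is_arg_max_linorder)
  then show ?thesis
    by (simp add: b_def N_def)
qed

end
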